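(* Let $d\ge1$ be an integer, $p\ge1$ a real number and $\alpha\in(0,1)$. Let $X_1,X_2,\ldots$ and $Y_1,Y_2,\ldots$ be two independent sequences of i.i.d. random vectors uniformly distributed on $[0,1]^d$. For integers $n\ge1$ such that $m:=n-\alpha n$ is an integer, define the optimal incomplete matching cost \[ T_{p,\alpha}(n)=\min_{X^*,Y^*}\min_{\pi}\frac1m\sum_{j=1}^m\bigl\|X_j^*-Y_{\pi(j)}^*\bigr\|^p, \] where $\pi$ ranges over the permutations of $\{1,\ldots,m\}$, $\{X_1^*,\ldots,X_m^*\}$ ranges over the subsets of size $m$ of $\{X_1,\ldots,X_n\}$, and $\{Y_1^*,\ldots,Y_m^*\}$ ranges over the subsets of size $m$ of $\{Y_1,\ldots,Y_n\}$. Then \[ \bigl(T_{p,\alpha}(n)\bigr)^{1/p}=O_P\bigl(n^{-1/d}\bigr) \] as $n\to\infty$ through integers for which $\alpha n$ is an integer; that is, for every $\varepsilon>0$ there exist $M<\infty$ and $n_0$ such that $\Pr\bigl(n^{1/d}\,(T_{p,\alpha}(n))^{1/p}>M\bigr)\le\varepsilon$ for all $n\ge n_0$ with $\alpha n$ an integer.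
   Context: $\|\cdot\|$ is the Euclidean norm on $\mathbb{R}^d$. *)

theory Defs
  imports "HOL-Probability.Probability" "HOL-Combinatorics.Permutations"
begin

(* Selecting by index keeps coinciding points apart: an injection \<sigma> in selections m n stands for
   the sub-sample of size m labelled X*_j = X_(\<sigma> j).  Samples are indexed from 0. *)
definition selections :: "nat \<Rightarrow> nat \<Rightarrow> (nat \<Rightarrow> nat) set" where
  "selections m n = {\<sigma> \<in> {..<m} \<rightarrow>\<^sub>E {..<n}. inj_on \<sigma> {..<m}}"

lemma finite_selections: "finite (selections m n)"
  unfolding selections_def
  by (rule finite_subset[where B = "{..<m} \<rightarrow>\<^sub>E {..<n}"]) (auto intro: finite_PiE)

lemma selections_nonempty:
  assumes "m \<le> n"
  shows "selections m n \<noteq> {}"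
proof -
  have "restrict id {..<m} \<in> selections m n"
    using assms by (auto simp: selections_def inj_on_def)
  then show ?thesis by blast
qed

(* Only meant for \<alpha> * n integral, in which case the floor is exact. *)
definition matching_size :: "real \<Rightarrow> nat \<Rightarrow> nat" where
  "matching_size \<alpha> n = nat \<lfloor>real n - \<alpha> * real n\<rfloor>"

lemma of_nat_matching_size:
  assumes "\<alpha> \<le> 1" "\<alpha> * real n \<in> \<int>"
  shows "real (matching_size \<alpha> n) = real n - \<alpha> * real n"
proof -
  have "real n - \<alpha> * real n \<in> \<int>"
    using assms(2) by (intro Ints_diff) auto
  moreover have "\<alpha> * real n \<le> 1 * real n"
    using assms(1) by (intro mult_right_mono) auto
  ultimately show ?thesis
    by (auto simp: matching_size_def elim!: Ints_cases)
qed

definition incomplete_matching_cost ::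
  "real \<Rightarrow> real \<Rightarrow> nat \<Rightarrow> (nat \<Rightarrow> 'b::real_normed_vector) \<Rightarrow> (nat \<Rightarrow> 'b) \<Rightarrow> real" where
  "incomplete_matching_cost p \<alpha> n x y =
    (let m = matching_size \<alpha> n in
      MIN \<sigma> \<in> selections m n. MIN \<tau> \<in> selections m n. MIN \<pi> \<in> {\<pi>. \<pi> permutes {..<m}}.
        (1 / real m) * (\<Sum>j<m. norm (x (\<sigma> j) - y (\<tau> (\<pi> j))) powr p))"

end

theory Submission
  imports Defs
begin

text \<open>
  Why a constant fraction of slack gives the rate \<open>n powr (-1/d)\<close> in every dimension: cut the cube into
  at most \<open>\<delta> n\<close> cells of side \<open>1/K\<close>, with \<open>\<delta>\<close> small but independent of \<open>n\<close>, and only match points that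
  share a cell. Every pair so obtained is at distance of order \<open>1/K\<close>, which is of order
  \<open>n powr (-1/d)\<close>. The points left over number at most
  \<open>\<Sum>c. \<bar>a c - b c\<bar>\<close>, where \<open>a c\<close> and \<open>b c\<close> count the two samples in the cell \<open>c\<close>
  (\<open>incomplete_matching_cost_grid_le\<close>, through \<open>cellwise_matching\<close>). The problem may discard
  \<open>\<alpha> n\<close> points of each sample, so it remains to see that this sum rarely exceeds \<open>\<alpha> n\<close>.

  A cell of probability \<open>q\<close> has a count of variance at most \<open>n q\<close>, and the \<open>q\<close> add up to at most 1, so
  the squared discrepancies have total expectation at most \<open>4 n\<close> whatever the number of cells
  (\<open>expectation_sum_hits_diff_le\<close>). Cauchy-Schwarz over the cells costs a factor equal to their
  number, at most \<open>\<delta> n\<close>, and Markov's inequality then bounds the failure probability by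
  \<open>4 n * \<delta> n / (\<alpha> n)^2 = 4 \<delta> / \<alpha>^2\<close> (\<open>prob_sum_hits_diff_le\<close>). The choice
  \<open>\<delta> = \<alpha>^2 \<epsilon> / 4\<close> makes this \<open>\<epsilon>\<close>.
\<close>

section \<open>Sample points in cells\<close>

definition hits :: "(nat \<Rightarrow> 'b) \<Rightarrow> nat \<Rightarrow> 'b set \<Rightarrow> nat" where
  "hits x n A = card {i. i < n \<and> x i \<in> A}"

lemma hits_eq_sum_indicator: "real (hits x n A) = (\<Sum>i<n. indicator A (x i))"
proof -
  have "{i. i < n \<and> x i \<in> A} = {..<n} \<inter> {i. x i \<in> A}" by auto
  then show ?thesis
    by (simp add: hits_def indicator_def sum.If_cases)
qed

lemma sum_hits_eq_sample_size:
  assumes "finite I" "disjoint_family_on cell I" "\<And>i. i < n \<Longrightarrow> x i \<in> (\<Union>c\<in>I. cell c)"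
  shows "(\<Sum>c\<in>I. hits x n (cell c)) = n"
proof -
  have "(\<Sum>c\<in>I. hits x n (cell c)) = card (\<Union>c\<in>I. {i. i < n \<and> x i \<in> cell c})"
    unfolding hits_def using assms(1,2)
    by (subst card_UN_disjoint) (auto simp: disjoint_family_on_def)
  also have "(\<Union>c\<in>I. {i. i < n \<and> x i \<in> cell c}) = {..<n}"
    using assms(3) by auto
  finally show ?thesis by simp
qed

section \<open>Concentration of cell counts\<close>

text \<open>
  The left-hand side is the variance of a binomial variable. Expanding the square of the sum of
  centred indicators, independence kills the off-diagonal terms and each of the \<open>n\<close> diagonal terms
  is \<open>q (1 - q)\<close>.
\<close>

lemma (in prob_space) expectation_hits_deviation_le:
  fixes X :: "nat \<Rightarrow> 'a \<Rightarrow> 'b"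
  assumes ind: "indep_vars (\<lambda>_. N) X UNIV" and A: "A \<in> sets N"
    and D: "\<And>i. distr M N (X i) = D"
  shows "expectation (\<lambda>\<omega>. (real (hits (\<lambda>i. X i \<omega>) n A) - real n * measure D A)\<^sup>2) \<le> real n * measure D A"
proof -
  define q where "q = measure D A"
  define W where "W = (\<lambda>i \<omega>. indicator A (X i \<omega>) - q)"
  have X[measurable]: "X i \<in> measurable M N" for i
    using ind by (auto simp: indep_vars_def)
  note A[measurable]
  have Wm[measurable]: "W i \<in> borel_measurable M" for i
    unfolding W_def by measurable
  have q01: "0 \<le> q" "q \<le> 1"
  proof -
    interpret D: prob_space D
      using prob_space_distr[OF X[of 0]] D[of 0] by simp
    show "0 \<le> q" "q \<le> 1" by (auto simp: q_def)
  qed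
  have bnd: "\<bar>W i \<omega>\<bar> \<le> 1" for i \<omega>
    using q01 by (auto simp: W_def indicator_def)
  have Wint: "integrable M (W i)" for i
    by (rule integrable_const_bound[where B=1]) (auto simp: bnd)
  have WWint: "integrable M (\<lambda>\<omega>. W i \<omega> * W j \<omega>)" for i j
    by (rule integrable_const_bound[where B=1]) (auto simp: abs_mult bnd mult_le_one)
  have Eind: "expectation (\<lambda>\<omega>. indicat_real A (X i \<omega>)) = q" for i
  proof -
    have "expectation (\<lambda>\<omega>. indicat_real A (X i \<omega>)) = (\<integral>x. indicat_real A x \<partial>distr M N (X i))"
      using A by (intro integral_distr[symmetric]) auto
    also have "\<dots> = q"
      using sets.sets_into_space[OF A] by (simp add: q_def Int_absorb2 flip: D[of i])
    finally show ?thesis .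
  qed
  have iint: "integrable M (\<lambda>\<omega>. indicator A (X i \<omega>) :: real)" for i
    by (rule integrable_const_bound[where B=1]) (auto simp: indicator_def)
  have EW: "expectation (W i) = 0" for i
    using iint Eind by (simp add: W_def prob_space)
  have EWW: "expectation (\<lambda>\<omega>. W i \<omega> * W j \<omega>) = (if i = j then q * (1 - q) else 0)" for i j
  proof (cases "i = j")
    case True
    have "(\<lambda>\<omega>. W i \<omega> * W i \<omega>) = (\<lambda>\<omega>. (1 - 2 * q) * indicator A (X i \<omega>) + q\<^sup>2)"
      by (auto simp: W_def indicator_def fun_eq_iff power2_eq_square algebra_simps)
    then show ?thesis
      using True iint Eind by (simp add: prob_space power2_eq_square algebra_simps)
  next
    case False
    have "indep_vars (\<lambda>_. borel) W UNIV"
      unfolding W_def by (rule indep_vars_compose2[OF ind]) measurable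
    then have "indep_vars (\<lambda>_. borel) W {i, j}"
      by (rule indep_vars_subset) auto
    from indep_vars_lebesgue_integral[OF _ this Wint] show ?thesis
      using False EW by simp
  qed
  have "expectation (\<lambda>\<omega>. (real (hits (\<lambda>i. X i \<omega>) n A) - real n * q)\<^sup>2)
      = expectation (\<lambda>\<omega>. \<Sum>i<n. \<Sum>j<n. W i \<omega> * W j \<omega>)"
    by (simp add: hits_eq_sum_indicator W_def sum_subtractf power2_eq_square flip: sum_product)
  also have "\<dots> = (\<Sum>i<n. \<Sum>j<n. if i = j then q * (1 - q) else 0)"
    using WWint by (simp add: EWW)
  also have "\<dots> = real n * (q * (1 - q))" by simp
  also have "\<dots> \<le> real n * q"
    using q01 by (intro mult_left_mono) (auto simp: mult_left_le)
  finally show ?thesis by (simp add: q_def)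
qed

text \<open>
  Both counts in a cell are compared with their common mean \<open>n q\<close>. Disjointness of the cells makes
  the \<open>q\<close> add up to at most 1, so that the bound is free of the number of cells.
\<close>

lemma (in prob_space) expectation_sum_hits_diff_le:
  fixes X Y :: "nat \<Rightarrow> 'a \<Rightarrow> 'b" and cell :: "'c \<Rightarrow> 'b set"
  assumes indX: "indep_vars (\<lambda>_. N) X UNIV" and indY: "indep_vars (\<lambda>_. N) Y UNIV"
    and DX: "\<And>i. distr M N (X i) = D" and DY: "\<And>i. distr M N (Y i) = D"
    and I: "finite I" "disjoint_family_on cell I" "\<And>c. c \<in> I \<Longrightarrow> cell c \<in> sets N"
  shows "expectation (\<lambda>\<omega>. \<Sum>c\<in>I. (real (hits (\<lambda>i. X i \<omega>) n (cell c)) - real (hits (\<lambda>i. Y i \<omega>) n (cell c)))\<^sup>2)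
      \<le> 4 * real n" (is ?le)
    and "integrable M (\<lambda>\<omega>. \<Sum>c\<in>I. (real (hits (\<lambda>i. X i \<omega>) n (cell c)) - real (hits (\<lambda>i. Y i \<omega>) n (cell c)))\<^sup>2)" (is ?int)
proof -
  have X[measurable]: "X i \<in> measurable M N" for i
    using indX by (auto simp: indep_vars_def)
  have Y[measurable]: "Y i \<in> measurable M N" for i
    using indY by (auto simp: indep_vars_def)
  interpret D: prob_space D
    using prob_space_distr[OF X[of 0]] DX[of 0] by simp
  have setsD: "sets D = sets N" using DX[of 0] by (metis sets_distr)
  define q where "q = (\<lambda>c. measure D (cell c))"
  define a where "a = (\<lambda>c \<omega>. real (hits (\<lambda>i. X i \<omega>) n (cell c)))"
  define b where "b = (\<lambda>c \<omega>. real (hits (\<lambda>i. Y i \<omega>) n (cell c)))"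
  have m[measurable]: "a c \<in> borel_measurable M" "b c \<in> borel_measurable M" if "c \<in> I" for c
    using I(3)[OF that] unfolding a_def b_def hits_eq_sum_indicator by measurable
  have hits_le: "hits x n A \<le> n" for x :: "nat \<Rightarrow> 'b" and A
    unfolding hits_def by (rule order_trans[OF card_mono[of "{..<n}"]]) auto
  have ab: "0 \<le> a c \<omega>" "a c \<omega> \<le> n" "0 \<le> b c \<omega>" "b c \<omega> \<le> n" for c \<omega>
    by (auto simp: a_def b_def hits_le)
  have q01: "0 \<le> q c" "q c \<le> 1" for c by (auto simp: q_def)
  have nq: "0 \<le> n * q c" "n * q c \<le> n" for c using q01 by (auto simp: mult_left_le)
  have sq: "(u - v)\<^sup>2 \<le> (real n)\<^sup>2" if "0 \<le> u" "u \<le> n" "0 \<le> v" "v \<le> n" for u v :: real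
  proof -
    have "\<bar>u - v\<bar> \<le> \<bar>real n\<bar>" using that by linarith
    then show ?thesis by (simp only: abs_le_square_iff)
  qed
  have int1: "integrable M (\<lambda>\<omega>. (a c \<omega> - b c \<omega>)\<^sup>2)" if "c \<in> I" for c
    using that ab[of c] by (intro integrable_const_bound[where B="(real n)\<^sup>2"] AE_I2) (auto intro!: sq)
  have int2: "integrable M (\<lambda>\<omega>. (a c \<omega> - n * q c)\<^sup>2)" "integrable M (\<lambda>\<omega>. (b c \<omega> - n * q c)\<^sup>2)" if "c \<in> I" for c
    using that ab[of c] nq[of c]
    by (intro integrable_const_bound[where B="(real n)\<^sup>2"] AE_I2; auto intro!: sq)+
  have one: "expectation (\<lambda>\<omega>. (a c \<omega> - b c \<omega>)\<^sup>2) \<le> 4 * n * q c" if c: "c \<in> I" for c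
  proof -
    have "(u - v)\<^sup>2 \<le> 2 * (u - w)\<^sup>2 + 2 * (v - w)\<^sup>2" for u v w :: real
      using zero_le_power2[of "(u - w) + (v - w)"] by (simp add: power2_eq_square algebra_simps)
    then have "expectation (\<lambda>\<omega>. (a c \<omega> - b c \<omega>)\<^sup>2)
        \<le> expectation (\<lambda>\<omega>. 2 * (a c \<omega> - n * q c)\<^sup>2 + 2 * (b c \<omega> - n * q c)\<^sup>2)"
      using int1[OF c] int2[OF c] by (intro integral_mono) auto
    also have "\<dots> = 2 * expectation (\<lambda>\<omega>. (a c \<omega> - n * q c)\<^sup>2) + 2 * expectation (\<lambda>\<omega>. (b c \<omega> - n * q c)\<^sup>2)"
      using int2[OF c] by simp
    also have "\<dots> \<le> 2 * (n * q c) + 2 * (n * q c)"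
      using expectation_hits_deviation_le[OF indX I(3)[OF c] DX, of n]
        expectation_hits_deviation_le[OF indY I(3)[OF c] DY, of n]
      unfolding a_def b_def q_def by linarith
    finally show ?thesis by simp
  qed
  have "(\<Sum>c\<in>I. q c) = measure D (\<Union>c\<in>I. cell c)"
    unfolding q_def using I setsD by (intro D.finite_measure_finite_Union[symmetric]) auto
  then have q_sum: "(\<Sum>c\<in>I. q c) \<le> 1" by simp
  have "expectation (\<lambda>\<omega>. \<Sum>c\<in>I. (a c \<omega> - b c \<omega>)\<^sup>2) = (\<Sum>c\<in>I. expectation (\<lambda>\<omega>. (a c \<omega> - b c \<omega>)\<^sup>2))"
    using int1 by simp
  also have "\<dots> \<le> (\<Sum>c\<in>I. 4 * n * q c)" by (intro sum_mono one)
  also have "\<dots> = 4 * n * (\<Sum>c\<in>I. q c)" by (simp add: sum_distrib_left)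
  also have "\<dots> \<le> 4 * n" using q_sum by (simp add: mult_left_le)
  finally show ?le by (simp add: a_def b_def)
  show ?int using int1 unfolding a_def b_def by (intro Bochner_Integration.integrable_sum) auto
qed

lemma (in prob_space) prob_sum_hits_diff_le:
  fixes X Y :: "nat \<Rightarrow> 'a \<Rightarrow> 'b" and cell :: "'c \<Rightarrow> 'b set" and t :: real and n :: nat
  assumes indX: "indep_vars (\<lambda>_. N) X UNIV" and indY: "indep_vars (\<lambda>_. N) Y UNIV"
    and DX: "\<And>i. distr M N (X i) = D" and DY: "\<And>i. distr M N (Y i) = D"
    and I: "finite I" "I \<noteq> {}" "disjoint_family_on cell I" "\<And>c. c \<in> I \<Longrightarrow> cell c \<in> sets N"
    and t: "0 < t"
  defines "S \<equiv> \<lambda>\<omega>. \<Sum>c\<in>I. \<bar>real (hits (\<lambda>i. X i \<omega>) n (cell c)) - real (hits (\<lambda>i. Y i \<omega>) n (cell c))\<bar>"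
  shows "prob {\<omega> \<in> space M. S \<omega> > t} \<le> 4 * real n * real (card I) / t\<^sup>2"
proof -
  define Q where "Q = (\<lambda>\<omega>. \<Sum>c\<in>I. (real (hits (\<lambda>i. X i \<omega>) n (cell c)) - real (hits (\<lambda>i. Y i \<omega>) n (cell c)))\<^sup>2)"
  define k where "k = real (card I)"
  have k: "k > 0" using I by (simp add: k_def card_gt_0_iff)
  note E = expectation_sum_hits_diff_le[OF indX indY DX DY I(1,3,4), where n=n, folded Q_def]
  have [measurable]: "Q \<in> borel_measurable M" using E(2) by auto
  have *: "t\<^sup>2 / k \<le> Q \<omega>" if "S \<omega> > t" for \<omega>
  proof -
    have "t\<^sup>2 \<le> (S \<omega>)\<^sup>2" using that t by (intro power_mono) auto
    also have "\<dots> \<le> Q \<omega> * k"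
      unfolding S_def Q_def k_def by (rule order_trans[OF sum_squared_le_sum_of_squares]) simp
    finally show ?thesis using k by (simp add: field_simps)
  qed
  have "prob {\<omega> \<in> space M. S \<omega> > t} \<le> prob {\<omega> \<in> space M. Q \<omega> \<ge> t\<^sup>2 / k}"
    using * by (intro finite_measure_mono) auto
  also have "\<dots> \<le> expectation Q / (t\<^sup>2 / k)"
    using E(2) t k by (intro integral_Markov_inequality_measure[where A="{}"])
      (auto simp: Q_def intro!: sum_nonneg)
  also have "\<dots> \<le> 4 * real n / (t\<^sup>2 / k)"
    using E(1) t k by (intro divide_right_mono) auto
  finally show ?thesis by (simp add: k_def)
qed

section \<open>Matching within cells\<close>

text \<open>
  Each cell admits a partial injection of size \<open>min (a c) (b c)\<close> between the indices of its points.
  These glue to one injection because cells are disjoint; any \<open>m\<close> of its pairs, listed by \<open>h\<close>, yield the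
  two selections, already aligned so that the identity permutation is the matching.
\<close>

lemma cellwise_matching:
  assumes I: "finite I" "disjoint_family_on cell I"
    and m: "m \<le> (\<Sum>c\<in>I. min (hits x n (cell c)) (hits y n (cell c)))"
  obtains \<sigma> \<tau> where "\<sigma> \<in> selections m n" "\<tau> \<in> selections m n"
    "\<And>j. j < m \<Longrightarrow> \<exists>c\<in>I. x (\<sigma> j) \<in> cell c \<and> y (\<tau> j) \<in> cell c"
proof -
  define a where "a = (\<lambda>c. {i. i < n \<and> x i \<in> cell c})"
  define b where "b = (\<lambda>c. {i. i < n \<and> y i \<in> cell c})"
  have fin: "finite (a c)" "finite (b c)" for c by (auto simp: a_def b_def)
  have "\<exists>A g. A \<subseteq> a c \<and> card A = min (card (a c)) (card (b c)) \<and> inj_on g A \<and> g ` A \<subseteq> b c" for c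
  proof -
    obtain A where A: "A \<subseteq> a c" "card A = min (card (a c)) (card (b c))"
      by (meson min.cobounded1 obtain_subset_with_card_n)
    moreover have "finite A" using A fin finite_subset by blast
    ultimately obtain g where "g ` A \<subseteq> b c" "inj_on g A"
      using fin by (metis card_le_inj min.cobounded2)
    with A show ?thesis by blast
  qed
  then obtain A g where A: "\<And>c. A c \<subseteq> a c" "\<And>c. card (A c) = min (card (a c)) (card (b c))"
    and g: "\<And>c. inj_on (g c) (A c)" "\<And>c. g c ` A c \<subseteq> b c" by metis
  define U where "U = (SIGMA c:I. A c)"
  have finA: "finite (A c)" for c using A(1) fin finite_subset by blast
  have "card U = (\<Sum>c\<in>I. card (A c))" unfolding U_def using I finA by (simp add: card_SigmaI)
  then have "m \<le> card U" using m A(2) by (simp add: hits_def a_def b_def)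
  then obtain h where h: "h ` {..<m} \<subseteq> U" "inj_on h {..<m}"
    using card_le_inj[of "{..<m}" U] I finA by (auto simp: U_def)
  have hU: "fst (h j) \<in> I" "snd (h j) \<in> A (fst (h j))" if "j < m" for j
    using h(1) that by (auto simp: U_def)
  have same: "c = c'" if "c \<in> I" "c' \<in> I" "z \<in> cell c" "z \<in> cell c'" for c c' z
    using I(2) that by (auto simp: disjoint_family_on_def)
  have inj: "inj_on (\<lambda>u. snd u) U" "inj_on (\<lambda>u. g (fst u) (snd u)) U"
  proof -
    show "inj_on (\<lambda>u. snd u) U"
      using A(1) same by (fastforce simp: inj_on_def U_def a_def)
    show "inj_on (\<lambda>u. g (fst u) (snd u)) U"
    proof (rule inj_onI)
      fix u v assume uv: "u \<in> U" "v \<in> U" "g (fst u) (snd u) = g (fst v) (snd v)"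
      then have "snd u \<in> A (fst u)" "snd v \<in> A (fst v)" by (auto simp: U_def)
      then have "g (fst u) (snd u) \<in> b (fst u)" "g (fst v) (snd v) \<in> b (fst v)"
        using g(2) by (blast intro: rev_subsetD)+
      then have "fst u = fst v" using uv same by (auto simp: U_def b_def)
      then show "u = v" using uv g(1)[of "fst u"] by (auto simp: U_def inj_on_def prod_eq_iff)
    qed
  qed
  define \<sigma> where "\<sigma> = restrict (\<lambda>j. snd (h j)) {..<m}"
  define \<tau> where "\<tau> = restrict (\<lambda>j. g (fst (h j)) (snd (h j))) {..<m}"
  have x: "snd (h j) < n \<and> x (snd (h j)) \<in> cell (fst (h j))" if "j < m" for j
    using hU(2)[OF that] A(1) by (auto simp: a_def)
  have y: "g (fst (h j)) (snd (h j)) < n \<and> y (g (fst (h j)) (snd (h j))) \<in> cell (fst (h j))" if "j < m" for j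
    using hU(2)[OF that] g(2)[of "fst (h j)"] by (auto simp: b_def)
  have "\<sigma> \<in> selections m n"
    using x comp_inj_on[OF h(2) inj_on_subset[OF inj(1) h(1)]]
    by (auto simp: selections_def \<sigma>_def inj_on_def)
  moreover have "\<tau> \<in> selections m n"
    using y comp_inj_on[OF h(2) inj_on_subset[OF inj(2) h(1)]]
    by (auto simp: selections_def \<tau>_def inj_on_def)
  moreover have "\<exists>c\<in>I. x (\<sigma> j) \<in> cell c \<and> y (\<tau> j) \<in> cell c" if "j < m" for j
    using x[OF that] y[OF that] hU(1)[OF that] that by (auto simp: \<sigma>_def \<tau>_def)
  ultimately show thesis by (rule that)
qed

text \<open>
  Needed because \<open>powr\<close> is monotone on nonnegative reals only; nonnegativity could fail if a minimum
  were taken over the empty set, where its value is unspecified.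
\<close>

lemma incomplete_matching_cost_nonneg:
  assumes "matching_size \<alpha> n \<le> n"
  shows "0 \<le> incomplete_matching_cost p \<alpha> n x y"
proof -
  define m where "m = matching_size \<alpha> n"
  have "{\<pi>. \<pi> permutes {..<m}} \<noteq> {}" using permutes_id[of "{..<m}"] by blast
  then show ?thesis
    using selections_nonempty[OF assms]
    unfolding incomplete_matching_cost_def Let_def m_def
    by (subst Min_ge_iff; auto simp: finite_selections finite_permutations
        intro!: sum_nonneg divide_nonneg_nonneg)+
qed

lemma incomplete_matching_cost_le:
  fixes x y :: "nat \<Rightarrow> 'b::real_normed_vector"
  assumes \<sigma>: "\<sigma> \<in> selections (matching_size \<alpha> n) n" and \<tau>: "\<tau> \<in> selections (matching_size \<alpha> n) n"
    and r: "\<And>j. j < matching_size \<alpha> n \<Longrightarrow> norm (x (\<sigma> j) - y (\<tau> j)) \<le> r" and "0 \<le> r" "0 \<le> p"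
  shows "incomplete_matching_cost p \<alpha> n x y \<le> r powr p"
proof -
  define m where "m = matching_size \<alpha> n"
  have fin: "finite {\<pi>. \<pi> permutes {..<m}}" by (simp add: finite_permutations)
  have idp: "id \<in> {\<pi>. \<pi> permutes {..<m}}" by (simp add: permutes_id)
  have "incomplete_matching_cost p \<alpha> n x y \<le> (1 / real m) * (\<Sum>j<m. norm (x (\<sigma> j) - y (\<tau> (id j))) powr p)"
    unfolding incomplete_matching_cost_def Let_def m_def[symmetric]
    by (rule order_trans[OF Min_le], simp add: finite_selections, rule imageI, rule \<sigma>[folded m_def],
        rule order_trans[OF Min_le], simp add: finite_selections, rule imageI, rule \<tau>[folded m_def],
        rule Min_le, simp add: fin, rule imageI, rule idp)
  also have "\<dots> \<le> (1 / real m) * (\<Sum>j<m. r powr p)"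
    using r assms(5) by (intro mult_left_mono sum_mono) (auto simp: m_def powr_mono2)
  also have "\<dots> \<le> r powr p" by (cases "m = 0") auto
  finally show ?thesis .
qed

section \<open>The grid of the unit cube\<close>

text \<open>
  Half-open cells keep the family disjoint. The faces of the cube where a coordinate equals 1 then
  fall into an extra layer with index \<open>K\<close>, hence \<open>K + 1\<close> values for each coordinate below.
\<close>

definition grid_cell :: "nat \<Rightarrow> ('d \<Rightarrow> nat) \<Rightarrow> (real ^ 'd) set" where
  "grid_cell K c = {x. \<forall>i. \<lfloor>real K * x $ i\<rfloor> = int (c i)}"

definition grid_index :: "nat \<Rightarrow> ('d \<Rightarrow> nat) set" where
  "grid_index K = (\<Pi>\<^sub>E i\<in>UNIV. {..K})"

lemma card_grid_index: "card (grid_index K :: ('d::finite \<Rightarrow> nat) set) = (K + 1) ^ CARD('d)"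
  by (simp add: grid_index_def card_PiE)

lemma finite_grid_index: "finite (grid_index K :: ('d::finite \<Rightarrow> nat) set)"
  by (simp add: grid_index_def finite_PiE)

lemma grid_index_nonempty: "(grid_index K :: ('d::finite \<Rightarrow> nat) set) \<noteq> {}"
  by (auto simp: grid_index_def PiE_eq_empty_iff)

lemma disjoint_grid_cells: "disjoint_family_on (grid_cell K) I"
  by (force simp: disjoint_family_on_def grid_cell_def)

lemma grid_cell_measurable: "grid_cell K c \<in> sets (borel :: (real ^ 'd::finite) measure)"
proof -
  have "(\<lambda>x::real^'d. x $ i) \<in> borel_measurable borel" for i
    by (intro borel_measurable_continuous_onI continuous_intros)
  note [measurable] = this
  have "{x \<in> space (borel :: (real ^ 'd) measure). \<forall>i. \<lfloor>real K * x $ i\<rfloor> = int (c i)} \<in> sets borel"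
    by measurable
  then show ?thesis by (simp add: grid_cell_def)
qed

lemma cbox_subset_grid: "cbox 0 1 \<subseteq> (\<Union>c\<in>grid_index K. grid_cell K (c :: 'd::finite \<Rightarrow> nat))"
proof
  fix x :: "real ^ 'd" assume "x \<in> cbox 0 1"
  then have x: "0 \<le> x $ i" "x $ i \<le> 1" for i by (auto simp: mem_box_cart)
  define c where "c = (\<lambda>i. nat \<lfloor>real K * x $ i\<rfloor>)"
  have "real K * x $ i \<le> real K" for i using x by (simp add: mult_left_le)
  then have "\<lfloor>real K * x $ i\<rfloor> \<le> int K" for i
    by (metis floor_mono floor_of_nat)
  then have "c \<in> grid_index K" by (auto simp: grid_index_def c_def nat_le_iff)
  moreover have "x \<in> grid_cell K c" using x by (auto simp: grid_cell_def c_def)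
  ultimately show "x \<in> (\<Union>c\<in>grid_index K. grid_cell K c)" by blast
qed

lemma norm_diff_grid_cell_le:
  fixes x y :: "real ^ 'd"
  assumes "x \<in> grid_cell K c" "y \<in> grid_cell K c" "0 < K"
  shows "norm (x - y) \<le> real CARD('d) / real K"
proof -
  have "\<bar>(x - y) $ i\<bar> \<le> 1 / real K" for i
  proof -
    have "\<lfloor>real K * x $ i\<rfloor> = \<lfloor>real K * y $ i\<rfloor>" using assms by (auto simp: grid_cell_def)
    then have "\<bar>real K * x $ i - real K * y $ i\<bar> \<le> 1" by linarith
    then have "real K * \<bar>(x - y) $ i\<bar> \<le> 1"
      by (simp add: abs_mult flip: right_diff_distrib)
    then show ?thesis using assms(3) by (simp add: field_simps)
  qed
  then have "(\<Sum>i\<in>UNIV. \<bar>(x - y) $ i\<bar>) \<le> of_nat CARD('d) * (1 / real K)"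
    by (intro sum_bounded_above) auto
  then show ?thesis using norm_le_l1_cart[of "x - y"] by simp
qed

section \<open>The matching cost\<close>

lemma incomplete_matching_cost_grid_le:
  fixes x y :: "nat \<Rightarrow> real ^ 'd"
  assumes x: "\<And>i. i < n \<Longrightarrow> x i \<in> cbox 0 1" and y: "\<And>i. i < n \<Longrightarrow> y i \<in> cbox 0 1"
    and \<alpha>: "0 \<le> \<alpha>" "\<alpha> \<le> 1" "\<alpha> * real n \<in> \<int>" and p: "0 < p" and K: "0 < K"
    and disc: "(\<Sum>c\<in>grid_index K. \<bar>real (hits x n (grid_cell K c)) - real (hits y n (grid_cell K c))\<bar>) \<le> \<alpha> * n"
  shows "incomplete_matching_cost p \<alpha> n x y powr (1 / p) \<le> real CARD('d) / real K"
proof -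
  define m where "m = matching_size \<alpha> n"
  define I where "I = (grid_index K :: ('d \<Rightarrow> nat) set)"
  define a where "a = (\<lambda>c. hits x n (grid_cell K c))"
  define b where "b = (\<lambda>c. hits y n (grid_cell K c))"
  have m: "real m = real n - \<alpha> * n"
    unfolding m_def by (rule of_nat_matching_size[OF \<alpha>(2,3)])
  have "real m \<le> real n" using m \<alpha>(1) by simp
  then have mn: "m \<le> n" by simp
  have fI: "finite I" and dI: "disjoint_family_on (grid_cell K) I"
    by (simp_all add: I_def finite_grid_index disjoint_grid_cells)
  have "(\<Sum>c\<in>I. a c) = n" unfolding a_def
    using cbox_subset_grid[of K] x by (intro sum_hits_eq_sample_size fI dI) (auto simp: I_def)
  moreover have "(\<Sum>c\<in>I. real (a c)) - (\<Sum>c\<in>I. real (min (a c) (b c)))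
      \<le> (\<Sum>c\<in>I. \<bar>real (a c) - real (b c)\<bar>)"
    unfolding sum_subtractf[symmetric] by (intro sum_mono) auto
  ultimately have "real n - real (\<Sum>c\<in>I. min (a c) (b c)) \<le> \<alpha> * n"
    using disc by (simp add: I_def a_def b_def flip: of_nat_sum)
  then have "real m \<le> real (\<Sum>c\<in>I. min (a c) (b c))" using m by linarith
  then have "m \<le> (\<Sum>c\<in>I. min (a c) (b c))" by (simp only: of_nat_le_iff)
  then obtain \<sigma> \<tau> where st: "\<sigma> \<in> selections m n" "\<tau> \<in> selections m n"
    "\<And>j. j < m \<Longrightarrow> \<exists>c\<in>I. x (\<sigma> j) \<in> grid_cell K c \<and> y (\<tau> j) \<in> grid_cell K c"
    using cellwise_matching[OF fI dI] unfolding a_def b_def by blast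
  have "incomplete_matching_cost p \<alpha> n x y \<le> (real CARD('d) / real K) powr p"
    using st(3) norm_diff_grid_cell_le[OF _ _ K] p
    by (intro incomplete_matching_cost_le[OF st(1,2)[unfolded m_def]]) (auto simp: m_def)
  then have "incomplete_matching_cost p \<alpha> n x y powr (1 / p) \<le> ((real CARD('d) / real K) powr p) powr (1 / p)"
    using p mn by (intro powr_mono2 incomplete_matching_cost_nonneg) (auto simp: m_def)
  also have "\<dots> = real CARD('d) / real K" using p by (simp add: powr_powr)
  finally show ?thesis .
qed

text \<open>
  A grid with at most \<open>s\<close> cells and side of order \<open>s powr (-1/d)\<close>: with \<open>t = s powr (1/d)\<close> take
  \<open>K = \<lfloor>t\<rfloor> - 1\<close>. From \<open>t \<ge> 4\<close> on, the loss from rounding and from the extra layer is within a factor 2.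
\<close>

lemma grid_resolution:
  fixes s :: real
  assumes s: "4 ^ d \<le> s" and d: "0 < d"
  obtains K :: nat where "0 < K" "real ((K + 1) ^ d) \<le> s" "s powr (1 / real d) \<le> 2 * real K"
proof -
  define t where "t = s powr (1 / real d)"
  define K where "K = nat \<lfloor>t\<rfloor> - 1"
  have s0: "0 < s" using s by (rule less_le_trans[rotated]) simp
  have "4 = (4 ^ d) powr (1 / real d)"
    using d by (simp add: powr_powr flip: powr_realpow)
  also have "\<dots> \<le> t" unfolding t_def using s by (intro powr_mono2) auto
  finally have t: "4 \<le> t" .
  have K: "real K = real_of_int \<lfloor>t\<rfloor> - 1" using t unfolding K_def by (simp add: of_nat_diff le_nat_iff le_floor_iff)
  have "t < real_of_int \<lfloor>t\<rfloor> + 1" by linarith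
  then have "real K + 1 \<le> t" "t \<le> 2 * real K" using K t by linarith+
  moreover have "0 < K" using t \<open>t \<le> 2 * real K\<close> by (cases K) auto
  moreover have "real ((K + 1) ^ d) \<le> t ^ d"
    using \<open>real K + 1 \<le> t\<close> by (simp add: power_mono add.commute)
  moreover have "t ^ d = s"
    using d s0 t by (simp add: t_def powr_powr flip: powr_realpow)
  ultimately show thesis using that by (auto simp: t_def)
qed

theorem mainTheorem3:
  fixes P :: "'a measure"
    and X Y :: "nat \<Rightarrow> 'a \<Rightarrow> real ^ 'd"
    and p \<alpha> :: real
  assumes "prob_space P"
    and "p \<ge> 1"
    and "0 < \<alpha>" and "\<alpha> < 1"
    and "prob_space.indep_vars P (\<lambda>_. borel) X UNIV"
    and "prob_space.indep_vars P (\<lambda>_. borel) Y UNIV"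
    and "prob_space.indep_var P
           (\<Pi>\<^sub>M i\<in>UNIV. borel) (\<lambda>\<omega> i. X i \<omega>) (\<Pi>\<^sub>M i\<in>UNIV. borel) (\<lambda>\<omega> i. Y i \<omega>)"
    and "\<And>i. distr P borel (X i) = uniform_measure lborel (cbox 0 1)"
    and "\<And>i. distr P borel (Y i) = uniform_measure lborel (cbox 0 1)"
  shows "\<forall>\<epsilon>>0. \<exists>C::real. \<exists>n\<^sub>0::nat. \<forall>n\<ge>n\<^sub>0. \<alpha> * real n \<in> \<int> \<longrightarrow>
           measure P {\<omega> \<in> space P.
             real n powr (1 / real CARD('d)) *
               (incomplete_matching_cost p \<alpha> n (\<lambda>i. X i \<omega>) (\<lambda>i. Y i \<omega>)) powr (1 / p) > C} \<le> \<epsilon>"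
proof (intro allI impI)
  interpret prob_space P by fact
  fix \<epsilon> :: real assume \<epsilon>: "\<epsilon> > 0"
  let ?D = "uniform_measure lborel (cbox 0 1) :: (real ^ 'd) measure"
  define d where "d = CARD('d)"
  have d: "0 < d" by (simp add: d_def)
  define \<delta> where "\<delta> = \<alpha>\<^sup>2 * \<epsilon> / 4"
  have \<delta>: "0 < \<delta>" using assms(3) \<epsilon> by (simp add: \<delta>_def)
  define C where "C = 2 * real d / \<delta> powr (1 / real d)"
  have XB: "random_variable borel (X i)" and YB: "random_variable borel (Y i)" for i
    using assms(5,6) by (auto simp: indep_vars_def)
  have D: "AE z in ?D. z \<in> cbox 0 1"
    by (intro AE_uniform_measureI) auto
  have "AE \<omega> in P. X i \<omega> \<in> cbox 0 1" for i
    by (rule AE_distrD[OF XB[of i]]) (unfold assms(8), rule D)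
  moreover have "AE \<omega> in P. Y i \<omega> \<in> cbox 0 1" for i
    by (rule AE_distrD[OF YB[of i]]) (unfold assms(9), rule D)
  ultimately have "AE \<omega> in P. X i \<omega> \<in> cbox 0 1 \<and> Y i \<omega> \<in> cbox 0 1" for i
    by (simp add: AE_conj_iff)
  then have "AE \<omega> in P. \<forall>i. X i \<omega> \<in> cbox 0 1 \<and> Y i \<omega> \<in> cbox 0 1"
    by (simp add: AE_all_countable)
  \<comment> \<open>The grid is only known to cover the cube; samples that leave it go into the null set \<open>Z\<close>.\<close>
  then obtain Z where Z: "Z \<in> null_sets P"
    "{\<omega> \<in> space P. \<not> (\<forall>i. X i \<omega> \<in> cbox 0 1 \<and> Y i \<omega> \<in> cbox 0 1)} \<subseteq> Z"
    by (elim AE_E) (auto simp: null_sets_def)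
  define n0 where "n0 = nat \<lceil>4 ^ d / \<delta>\<rceil>"
  have n0: "4 ^ d \<le> \<delta> * real n" if "n \<ge> n0" for n
  proof -
    have "4 ^ d / \<delta> \<le> real n" using that by (simp add: n0_def)
    then show ?thesis using \<delta> by (simp add: field_simps)
  qed
  have "measure P {\<omega> \<in> space P. real n powr (1 / real CARD('d)) *
      (incomplete_matching_cost p \<alpha> n (\<lambda>i. X i \<omega>) (\<lambda>i. Y i \<omega>)) powr (1 / p) > C} \<le> \<epsilon>"
    if n: "n \<ge> max n0 1" "\<alpha> * real n \<in> \<int>" for n
  proof -
    have npos: "real n > 0" using n by simp
    obtain K where K: "0 < K" "real ((K + 1) ^ d) \<le> \<delta> * n" "(\<delta> * n) powr (1 / real d) \<le> 2 * real K"
      using grid_resolution[OF n0 d, of n] n by auto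
    define S where "S = (\<lambda>\<omega>. \<Sum>c\<in>grid_index K. \<bar>real (hits (\<lambda>i. X i \<omega>) n (grid_cell K c))
      - real (hits (\<lambda>i. Y i \<omega>) n (grid_cell K c))\<bar>)"
    have [measurable]: "S \<in> borel_measurable P"
      using XB YB grid_cell_measurable unfolding S_def hits_eq_sum_indicator by measurable
    have C: "real n powr (1 / real d) * (real d / real K) \<le> C"
    proof -
      have "\<delta> powr (1 / real d) * real n powr (1 / real d) \<le> 2 * real K"
        using K(3) \<delta> npos by (simp add: powr_mult)
      then show ?thesis using K(1) \<delta> d by (simp add: C_def field_simps mult_left_mono)
    qed
    have good: "real n powr (1 / real d) * incomplete_matching_cost p \<alpha> n (\<lambda>i. X i \<omega>) (\<lambda>i. Y i \<omega>) powr (1 / p) \<le> C"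
      if "\<omega> \<in> space P" "\<omega> \<notin> Z" "S \<omega> \<le> \<alpha> * n" for \<omega>
    proof -
      have "X i \<omega> \<in> cbox 0 1" "Y i \<omega> \<in> cbox 0 1" for i using that Z(2) by auto
      then have "incomplete_matching_cost p \<alpha> n (\<lambda>i. X i \<omega>) (\<lambda>i. Y i \<omega>) powr (1 / p) \<le> real d / real K"
        unfolding d_def using that(3) assms(2-4) n(2) K(1)
        by (intro incomplete_matching_cost_grid_le) (auto simp: S_def)
      then show ?thesis using C by (meson mult_left_mono order_trans powr_ge_zero)
    qed
    \<comment> \<open>Measurability of the cost is bypassed by passing to a measurable superset.\<close>
    have "prob {\<omega> \<in> space P. real n powr (1 / real CARD('d)) *
        (incomplete_matching_cost p \<alpha> n (\<lambda>i. X i \<omega>) (\<lambda>i. Y i \<omega>)) powr (1 / p) > C}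
        \<le> prob ({\<omega> \<in> space P. S \<omega> > \<alpha> * n} \<union> Z)"
      using Z(1) good by (intro finite_measure_mono) (auto simp: d_def[symmetric] not_le[symmetric])
    also have "\<dots> = prob {\<omega> \<in> space P. S \<omega> > \<alpha> * n}"
      using Z(1) by (intro measure_Un_null_set) auto
    also have "\<dots> \<le> 4 * real n * real (card (grid_index K :: ('d \<Rightarrow> nat) set)) / (\<alpha> * n)\<^sup>2"
      unfolding S_def using assms(3) npos
      by (intro prob_sum_hits_diff_le[OF assms(5,6,8,9) finite_grid_index grid_index_nonempty
            disjoint_grid_cells grid_cell_measurable]) auto
    also have "\<dots> \<le> 4 * real n * (\<delta> * n) / (\<alpha> * n)\<^sup>2"
      using K(2) unfolding card_grid_index d_def[symmetric]
      by (intro divide_right_mono mult_left_mono) auto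
    also have "\<dots> = \<epsilon>"
      using assms(3) npos by (simp add: \<delta>_def power2_eq_square)
    finally show ?thesis .
  qed
  then show "\<exists>C::real. \<exists>n\<^sub>0::nat. \<forall>n\<ge>n\<^sub>0. \<alpha> * real n \<in> \<int> \<longrightarrow>
           measure P {\<omega> \<in> space P.
             real n powr (1 / real CARD('d)) *
               (incomplete_matching_cost p \<alpha> n (\<lambda>i. X i \<omega>) (\<lambda>i. Y i \<omega>)) powr (1 / p) > C} \<le> \<epsilon>"
    by blast
qed

end
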